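(* Let $\lambda\in(0,1]$ and let $X\sim DB_\lambda(\alpha,\theta)$. Then the moment generating function $F_X(t)=E[e^{Xt}]=\sum_{n=0}^\infty E[X^n]\frac{t^n}{n!}$ of $X$ is \[ F_X(t)=e^{\alpha(e_\lambda(e^t\theta)-e_\lambda(\theta))}. \]
   Context: For nonzero real $\lambda$, the degenerate exponential is $e_\lambda^x(t)=(1+\lambda t)^{x/\lambda}=\sum_{n=0}^\infty \frac{(x)_{n,\lambda}}{n!}t^n$, with $e_\lambda(t)=e_\lambda^1(t)$, where $(x)_{0,\lambda}=1$ and $(x)_{n,\lambda}=x(x-\lambda)\cdots(x-(n-1)\lambda)$ for $n\ge1$. The degenerate Bell polynomials $\phi_{n,\lambda}(x)$ are defined by $e^{x(e_\lambda(t)-1)}=\sum_{n=0}^\infty \phi_{n,\lambda}(x)\frac{t^n}{n!}$. A discrete random variable $X$ taking values in $\{0,1,2,\dots\}$ has the degenerate Bell distribution with parameters $(\alpha,\theta)\in\mathbb{R}^2$, written $X\sim DB_\lambda(\alpha,\theta)$, if $P\{X=k\}=e^{-\alpha(e_\lambda(\theta)-1)}\frac{\theta^k}{k!}\phi_{k,\lambda}(\alpha)$ for all $k\ge0$ (parameters being such that these numbers form a probability mass function). *)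

theory Defs
  imports
    "HOL-Probability.Probability"
    "HOL-Analysis.Generalised_Binomial_Theorem"
    "HOL-Computational_Algebra.Formal_Power_Series"
begin

definition degen_falling :: "real \<Rightarrow> real \<Rightarrow> nat \<Rightarrow> real"
  where "degen_falling l x n = (\<Prod>i<n. x - real i * l)"

text \<open>
  The real power \<open>(1 + l * t) ^ (x / l)\<close>.  \<open>powr\<close> is only meaningful for a
  nonnegative base, but for an integer exponent the power (and its binomial series) makes sense
  for negative bases as well, so this case is treated with \<open>powi\<close>.
\<close>
definition degen_exp :: "real \<Rightarrow> real \<Rightarrow> real \<Rightarrow> real"
  where "degen_exp l x t =
    (if x / l \<in> \<int> then (1 + l * t) powi \<lfloor>x / l\<rfloor> else (1 + l * t) powr (x / l))"

definition degen_exp_fps :: "real \<Rightarrow> real \<Rightarrow> real fps"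
  where "degen_exp_fps l x = Abs_fps (\<lambda>n. degen_falling l x n / fact n)"

lemma degen_falling_eq_gchoose:
  assumes "l \<noteq> 0"
  shows "degen_falling l x n / fact n = ((x / l) gchoose n) * l ^ n"
proof -
  have "degen_falling l x n = (\<Prod>i<n. l * (x / l - real i))"
    unfolding degen_falling_def using assms by (intro prod.cong) (auto simp: field_simps)
  also have "\<dots> = l ^ n * (\<Prod>i<n. x / l - real i)"
    by (simp add: prod.distrib)
  finally show ?thesis
    by (simp add: gbinomial_prod_rev atLeast0LessThan)
qed

lemma degen_exp_sums:
  assumes "l \<noteq> 0" "\<bar>l * t\<bar> < 1"
  shows "(\<lambda>n. fps_nth (degen_exp_fps l x) n * t ^ n) sums degen_exp l x t"
proof -
  have pos: "1 + l * t > 0" using assms(2) by linarith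
  have eq: "degen_exp l x t = (1 + l * t) powr (x / l)"
  proof (cases "x / l \<in> \<int>")
    case True
    then obtain m :: int where m: "x / l = of_int m" by (elim Ints_cases)
    show ?thesis using pos unfolding degen_exp_def m
      by (simp add: powr_real_of_int' )
  qed (simp add: degen_exp_def)
  have "(\<lambda>n. ((x / l) gchoose n) * (l * t) ^ n) sums (1 + l * t) powr (x / l)"
    using assms(2) by (rule gen_binomial_real)
  then show ?thesis
    unfolding eq degen_exp_fps_def using assms(1)
    by (simp add: degen_falling_eq_gchoose power_mult_distrib mult_ac)
qed

text \<open>
  The generating function \<open>exp (x * (e(t) - 1))\<close>, read as a formal power series in \<open>t\<close>:
  the composition of \<open>exp (x * _)\<close> with \<open>e - 1\<close>, which has constant term 0.
\<close>
definition degen_bell :: "real \<Rightarrow> nat \<Rightarrow> real \<Rightarrow> real"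
  where "degen_bell l n x = fact n * fps_nth (fps_exp x oo (degen_exp_fps l 1 - 1)) n"

text \<open>
  That the given numbers form a probability mass function is part of the condition, since the
  probabilities of the events \<open>X = k\<close> are nonnegative and add up to 1.
\<close>
definition degen_bell_distributed ::
    "'a measure \<Rightarrow> ('a \<Rightarrow> nat) \<Rightarrow> real \<Rightarrow> real \<Rightarrow> real \<Rightarrow> bool"
  where "degen_bell_distributed M X l \<alpha> \<theta> \<longleftrightarrow>
    prob_space M \<and> X \<in> M \<rightarrow>\<^sub>M count_space UNIV \<and>
    (\<forall>k. measure M {\<omega> \<in> space M. X \<omega> = k} =
       exp (- \<alpha> * (degen_exp l 1 \<theta> - 1)) * (\<theta> ^ k / fact k) * degen_bell l k \<alpha>)"

definition mgf :: "'a measure \<Rightarrow> ('a \<Rightarrow> real) \<Rightarrow> real \<Rightarrow> real"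
  where "mgf M X t = prob_space.expectation M (\<lambda>\<omega>. exp (X \<omega> * t))"

end

(*
  The exponential generating function of the degenerate Bell polynomials is exp (alpha * (e - 1)),
  so E[exp (X t)] is exp (- alpha * (e theta - 1)) times its value at z = exp t * theta, provided
  that the power series represents the function wherever it converges. If 1/l is a natural number,
  everything is entire. Otherwise the binomial series converges absolutely on the closed disc
  |l z| <= 1, since 1/l > 0, and composition with exp preserves absolute convergence, including on
  the boundary. For alpha /= 0 the composed series diverges beyond the disc: otherwise its sum F would be
  holomorphic at -1/l, and the zero of exp alpha * F - 1 there would have integer order, whereas for
  real arguments this function behaves like alpha * (1 + l x) powr (1/l).
*)

theory Submission
  imports
    Defs
    "HOL-Complex_Analysis.Complex_Analysis"
    "HOL-Real_Asymp.Real_Asymp"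
begin

section \<open>Absolute convergence of products, powers and compositions at a point\<close>

text \<open>The terms of \<open>f * g\<close> are finite convolutions, so the Cauchy product of the
  absolute series dominates them. Working at a single point \<open>z\<close>, rather than inside the
  radius of convergence, keeps boundary points covered.\<close>

lemma fps_mult_abs_summable:
  fixes f g :: "real fps"
  assumes f: "summable (\<lambda>n. \<bar>fps_nth f n * z ^ n\<bar>)" and g: "summable (\<lambda>n. \<bar>fps_nth g n * z ^ n\<bar>)"
  shows "summable (\<lambda>n. \<bar>fps_nth (f * g) n * z ^ n\<bar>)"
    and "(\<Sum>n. \<bar>fps_nth (f * g) n * z ^ n\<bar>) \<le>
      (\<Sum>n. \<bar>fps_nth f n * z ^ n\<bar>) * (\<Sum>n. \<bar>fps_nth g n * z ^ n\<bar>)"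
    and "(\<Sum>n. fps_nth (f * g) n * z ^ n) = (\<Sum>n. fps_nth f n * z ^ n) * (\<Sum>n. fps_nth g n * z ^ n)"
proof -
  let ?a = "\<lambda>n. fps_nth f n * z ^ n" and ?b = "\<lambda>n. fps_nth g n * z ^ n"
  have eq: "fps_nth (f * g) n * z ^ n = (\<Sum>i\<le>n. ?a i * ?b (n - i))" for n
    unfolding fps_mult_nth atLeast0AtMost sum_distrib_right
    by (rule sum.cong) (simp_all add: mult_ac flip: power_add)
  have abs: "(\<lambda>n. \<Sum>i\<le>n. \<bar>?a i\<bar> * \<bar>?b (n - i)\<bar>) sums ((\<Sum>n. \<bar>?a n\<bar>) * (\<Sum>n. \<bar>?b n\<bar>))"
    by (rule Cauchy_product_sums) (use f g in simp_all)
  have le: "\<bar>fps_nth (f * g) n * z ^ n\<bar> \<le> (\<Sum>i\<le>n. \<bar>?a i\<bar> * \<bar>?b (n - i)\<bar>)" for n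
    unfolding eq by (rule order_trans[OF sum_abs]) (simp add: abs_mult)
  show s: "summable (\<lambda>n. \<bar>fps_nth (f * g) n * z ^ n\<bar>)"
    by (rule summable_comparison_test'[OF sums_summable[OF abs], of 0]) (use le in simp)
  show "(\<Sum>n. \<bar>fps_nth (f * g) n * z ^ n\<bar>) \<le> (\<Sum>n. \<bar>?a n\<bar>) * (\<Sum>n. \<bar>?b n\<bar>)"
    using suminf_le[OF le s sums_summable[OF abs]] sums_unique[OF abs] by simp
  have "(\<lambda>n. \<Sum>i\<le>n. ?a i * ?b (n - i)) sums ((\<Sum>n. ?a n) * (\<Sum>n. ?b n))"
    by (rule Cauchy_product_sums) (use f g in simp_all)
  then show "(\<Sum>n. fps_nth (f * g) n * z ^ n) = (\<Sum>n. ?a n) * (\<Sum>n. ?b n)"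
    unfolding eq by (rule sums_unique[symmetric])
qed

text \<open>The bound by the \<open>j\<close>-th power is what later controls the rows of the double
  series for a composition with exp.\<close>

lemma fps_power_abs_summable:
  fixes f :: "real fps"
  assumes f: "summable (\<lambda>n. \<bar>fps_nth f n * z ^ n\<bar>)"
  shows "summable (\<lambda>n. \<bar>fps_nth (f ^ j) n * z ^ n\<bar>)"
    and "(\<Sum>n. \<bar>fps_nth (f ^ j) n * z ^ n\<bar>) \<le> (\<Sum>n. \<bar>fps_nth f n * z ^ n\<bar>) ^ j"
    and "(\<Sum>n. fps_nth (f ^ j) n * z ^ n) = (\<Sum>n. fps_nth f n * z ^ n) ^ j"
proof -
  have "summable (\<lambda>n. \<bar>fps_nth (f ^ j) n * z ^ n\<bar>) \<and>
    (\<Sum>n. \<bar>fps_nth (f ^ j) n * z ^ n\<bar>) \<le> (\<Sum>n. \<bar>fps_nth f n * z ^ n\<bar>) ^ j \<and>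
    (\<Sum>n. fps_nth (f ^ j) n * z ^ n) = (\<Sum>n. fps_nth f n * z ^ n) ^ j"
  proof (induction j)
    case 0
    have "(\<lambda>n. \<bar>fps_nth (1 :: real fps) n * z ^ n\<bar>) sums 1" "(\<lambda>n. fps_nth (1 :: real fps) n * z ^ n) sums 1"
      using sums_single[of 0 "\<lambda>_. 1 :: real"] by (simp_all add: if_distrib if_distribR cong: if_cong)
    then show ?case by (simp add: sums_iff)
  next
    case (Suc j)
    have "(\<Sum>n. \<bar>fps_nth (f * f ^ j) n * z ^ n\<bar>) \<le>
        (\<Sum>n. \<bar>fps_nth f n * z ^ n\<bar>) * (\<Sum>n. \<bar>fps_nth (f ^ j) n * z ^ n\<bar>)"
      using Suc f by (intro fps_mult_abs_summable) auto
    also have "\<dots> \<le> (\<Sum>n. \<bar>fps_nth f n * z ^ n\<bar>) * (\<Sum>n. \<bar>fps_nth f n * z ^ n\<bar>) ^ j"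
      using Suc f by (intro mult_left_mono suminf_nonneg) auto
    finally show ?case
      using Suc f fps_mult_abs_summable(1,3)[of f z "f ^ j"] by simp
  qed
  then show "summable (\<lambda>n. \<bar>fps_nth (f ^ j) n * z ^ n\<bar>)"
    and "(\<Sum>n. \<bar>fps_nth (f ^ j) n * z ^ n\<bar>) \<le> (\<Sum>n. \<bar>fps_nth f n * z ^ n\<bar>) ^ j"
    and "(\<Sum>n. fps_nth (f ^ j) n * z ^ n) = (\<Sum>n. fps_nth f n * z ^ n) ^ j"
    by blast+
qed

text \<open>Fubini for the double series with entries \<open>a (j, n)\<close>: the rows have
  absolute sums at most \<open>(\<bar>c\<bar> * N) ^ j / fact j\<close>, so the family is absolutely
  summable. Summing by rows gives the exponential series, summing by columns the series of the
  composition.\<close>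

lemma fps_exp_compose_abs_summable:
  fixes f :: "real fps"
  assumes f: "summable (\<lambda>n. \<bar>fps_nth f n * z ^ n\<bar>)" and f0: "fps_nth f 0 = 0"
  shows "summable (\<lambda>n. \<bar>fps_nth (fps_exp c oo f) n * z ^ n\<bar>)"
    and "(\<lambda>n. fps_nth (fps_exp c oo f) n * z ^ n) sums exp (c * (\<Sum>n. fps_nth f n * z ^ n))"
proof -
  define N where "N = (\<Sum>n. \<bar>fps_nth f n * z ^ n\<bar>)"
  define a where "a = (\<lambda>(j, n). c ^ j / fact j * (fps_nth (f ^ j) n * z ^ n))"
  have row_abs: "((\<lambda>n. \<bar>a (j, n)\<bar>) has_sum \<bar>c ^ j / fact j\<bar> * (\<Sum>n. \<bar>fps_nth (f ^ j) n * z ^ n\<bar>)) UNIV" for j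
    unfolding a_def prod.case abs_mult[of "c ^ j / fact j"]
    by (intro has_sum_cmult_right sums_nonneg_imp_has_sum summable_sums fps_power_abs_summable f) simp
  have row: "((\<lambda>n. a (j, n)) has_sum c ^ j / fact j * (\<Sum>n. fps_nth f n * z ^ n) ^ j) UNIV" for j
    unfolding a_def prod.case fps_power_abs_summable(3)[OF f, symmetric]
    using fps_power_abs_summable(1)[OF f, of j]
    by (intro has_sum_cmult_right norm_summable_imp_has_sum summable_sums) (auto dest: summable_rabs_cancel)
  have "summable (\<lambda>j. \<bar>c ^ j / fact j\<bar> * (\<Sum>n. \<bar>fps_nth (f ^ j) n * z ^ n\<bar>))"
  proof (rule summable_comparison_test'[of "\<lambda>j. (\<bar>c\<bar> * N) ^ j /\<^sub>R fact j" 0])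
    show "summable (\<lambda>j. (\<bar>c\<bar> * N) ^ j /\<^sub>R fact j)"
      by (rule summable_exp_generic)
    fix j :: nat
    have "\<bar>c ^ j / fact j\<bar> * (\<Sum>n. \<bar>fps_nth (f ^ j) n * z ^ n\<bar>) \<le> \<bar>c ^ j / fact j\<bar> * N ^ j"
      unfolding N_def by (intro mult_left_mono fps_power_abs_summable f) simp
    moreover have "0 \<le> (\<Sum>n. \<bar>fps_nth (f ^ j) n * z ^ n\<bar>)"
      by (intro suminf_nonneg fps_power_abs_summable f) simp
    ultimately show "norm (\<bar>c ^ j / fact j\<bar> * (\<Sum>n. \<bar>fps_nth (f ^ j) n * z ^ n\<bar>)) \<le> (\<bar>c\<bar> * N) ^ j /\<^sub>R fact j"
      by (simp add: power_mult_distrib power_abs abs_mult field_simps)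
  qed
  then have "(\<lambda>j. \<bar>c ^ j / fact j\<bar> * (\<Sum>n. \<bar>fps_nth (f ^ j) n * z ^ n\<bar>)) summable_on UNIV"
    by (intro summable_nonneg_imp_summable_on mult_nonneg_nonneg suminf_nonneg fps_power_abs_summable f) auto
  with row_abs have abs: "(\<lambda>x. \<bar>a x\<bar>) summable_on UNIV \<times> UNIV"
    by (intro summable_on_SigmaI) auto
  then have "a summable_on UNIV \<times> UNIV"
    using abs_summable_summable[of a] by simp
  then obtain S where S: "(a has_sum S) (UNIV \<times> UNIV)"
    by (auto simp: summable_on_def)
  have "(\<lambda>j. c ^ j / fact j * (\<Sum>n. fps_nth f n * z ^ n) ^ j) sums S"
    using has_sum_SigmaD[OF S row] by (rule has_sum_imp_sums)
  moreover have "(\<lambda>j. c ^ j / fact j * (\<Sum>n. fps_nth f n * z ^ n) ^ j) sums exp (c * (\<Sum>n. fps_nth f n * z ^ n))"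
    using exp_converges[of "c * (\<Sum>n. fps_nth f n * z ^ n)"]
    by (simp add: power_mult_distrib field_simps)
  ultimately have S_eq: "S = exp (c * (\<Sum>n. fps_nth f n * z ^ n))"
    by (rule sums_unique2)
  \<comment> \<open>As \<open>f\<close> has no constant term, \<open>f ^ j\<close> starts at order
    \<open>j\<close>. Column \<open>n\<close> thus vanishes beyond \<open>j = n\<close>, and its sum
    is the finite sum defining the coefficient of the composition.\<close>
  have col: "((\<lambda>j. a (j, n)) has_sum fps_nth (fps_exp c oo f) n * z ^ n) UNIV" for n
  proof (rule has_sum_finite_neutralI[of "{0..n}"])
    show "a (j, n) = 0" if "j \<in> UNIV - {0..n}" for j
      using that startsby_zero_power_prefix[OF f0] by (auto simp: a_def)
    show "fps_nth (fps_exp c oo f) n * z ^ n = (\<Sum>j\<in>{0..n}. a (j, n))"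
      by (simp add: fps_compose_nth a_def sum_distrib_right mult.assoc)
  qed auto
  \<comment> \<open>Each column sum is bounded by the absolute sum of its column, and those are
    summable over \<open>n\<close> because the family with swapped indices is absolutely summable
    too.\<close>
  have col_sum: "(\<lambda>n. norm (fps_nth (fps_exp c oo f) n * z ^ n)) summable_on UNIV"
  proof -
    have "(\<lambda>p. norm (case p of (n, j) \<Rightarrow> a (j, n))) summable_on UNIV \<times> UNIV"
      using abs summable_on_swap[of "\<lambda>x. \<bar>a x\<bar>" UNIV UNIV] by (simp add: case_prod_unfold)
    then have s: "(\<lambda>n. infsum (\<lambda>j. \<bar>a (j, n)\<bar>) UNIV) summable_on UNIV"
      and c: "(\<lambda>j. norm (a (j, n))) summable_on UNIV" for n
      using Infinite_Sum.abs_summable_on_Sigma_iff[of "\<lambda>(n, j). a (j, n)" UNIV "\<lambda>_. UNIV"]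
      by (auto simp: infsum_nonneg)
    show ?thesis
    proof (rule summable_on_comparison_test[OF s])
      fix n
      show "norm (fps_nth (fps_exp c oo f) n * z ^ n) \<le> infsum (\<lambda>j. \<bar>a (j, n)\<bar>) UNIV"
        using norm_infsum_bound[OF c, of n] infsumI[OF col[of n]] by simp
    qed auto
  qed
  then show "summable (\<lambda>n. \<bar>fps_nth (fps_exp c oo f) n * z ^ n\<bar>)"
    by (simp add: summable_on_imp_summable)
  have "((\<lambda>(n, j). a (j, n)) has_sum S) (UNIV \<times> UNIV)"
    using S has_sum_swap[of a UNIV UNIV S] by simp
  then show "(\<lambda>n. fps_nth (fps_exp c oo f) n * z ^ n) sums exp (c * (\<Sum>n. fps_nth f n * z ^ n))"
    unfolding S_eq[symmetric]
    by (rule has_sum_imp_sums[OF has_sum_SigmaD]) (use col in simp)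
qed

section \<open>The binomial series on the closed disc\<close>

text \<open>
  With \<open>c n = n * \<bar>a gchoose n\<bar>\<close>, the differences \<open>c n - c (Suc n)\<close> equal \<open>a * \<bar>a gchoose n\<bar>\<close> for
  \<open>n \<ge> a\<close>, so the series telescopes.
\<close>
lemma summable_abs_gchoose:
  fixes a :: real
  assumes "a > 0"
  shows "summable (\<lambda>n. \<bar>a gchoose n\<bar>)"
proof -
  define c where "c n = real n * \<bar>a gchoose n\<bar>" for n
  define N where "N = nat \<lceil>a\<rceil>"
  have rec: "c n - c (Suc n) = a * \<bar>a gchoose n\<bar>" if "n \<ge> N" for n
  proof -
    have an: "a \<le> real n" using that unfolding N_def by linarith
    have "real (Suc n) * (a gchoose Suc n) = (a - real n) * (a gchoose n)"
      using gbinomial_mult_1[of a n] by (simp add: algebra_simps)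
    then have "c (Suc n) = \<bar>(a - real n) * (a gchoose n)\<bar>"
      unfolding c_def by (metis abs_mult abs_of_nat)
    also have "\<dots> = (real n - a) * \<bar>a gchoose n\<bar>"
      using an by (simp add: abs_mult)
    finally show ?thesis by (simp add: c_def algebra_simps)
  qed
  \<comment> \<open>From \<open>N\<close> on the differences are nonnegative, so \<open>c\<close>
    decreases and, being bounded below by 0, has the limit that makes the telescoping series
    converge.\<close>
  have "decseq (\<lambda>n. c (n + N))"
  proof (rule decseq_SucI)
    fix n
    have "0 \<le> c (n + N) - c (Suc (n + N))" using assms by (subst rec) auto
    then show "c (Suc n + N) \<le> c (n + N)" by simp
  qed
  moreover have "0 \<le> c (n + N)" for n by (simp add: c_def)
  ultimately obtain L where "(\<lambda>n. c (n + N)) \<longlonglongrightarrow> L"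
    using decseq_convergent by metis
  then have "summable (\<lambda>n. c (n + N) - c (Suc n + N))"
    by (rule telescope_summable')
  then have "summable (\<lambda>n. a * \<bar>a gchoose (n + N)\<bar>)"
    using rec by simp
  then have "summable (\<lambda>n. \<bar>a gchoose (n + N)\<bar>)"
    using assms by (simp add: summable_cmult_iff)
  then show ?thesis
    by (subst (asm) summable_iff_shift)
qed

lemma degen_exp_fps_nth:
  assumes "l \<noteq> 0"
  shows "fps_nth (degen_exp_fps l x) n * z ^ n = ((x / l) gchoose n) * (l * z) ^ n"
  using assms by (simp add: degen_exp_fps_def degen_falling_eq_gchoose power_mult_distrib)

text \<open>For natural \<open>1 / l\<close> the series is a polynomial. On the closed disc the
  powers of \<open>l * z\<close> are bounded by 1, so the binomial coefficients, summable for a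
  positive exponent, form a majorant.\<close>

lemma degen_exp_fps_abs_summable:
  assumes "l > 0" and z: "1 / l \<in> \<nat> \<or> \<bar>l * z\<bar> \<le> 1"
  shows "summable (\<lambda>n. \<bar>fps_nth (degen_exp_fps l 1) n * z ^ n\<bar>)"
  using z
proof
  assume "1 / l \<in> \<nat>"
  then obtain m where "1 / l = real m" by (auto elim: Nats_cases)
  then show ?thesis using assms(1)
    by (intro summable_finite[of "{..m}"]) (auto simp: degen_exp_fps_nth simp flip: binomial_gbinomial)
next
  assume lz: "\<bar>l * z\<bar> \<le> 1"
  show ?thesis
  proof (rule summable_comparison_test'[OF summable_abs_gchoose[of "1 / l"], of 0])
    show "norm \<bar>fps_nth (degen_exp_fps l 1) n * z ^ n\<bar> \<le> \<bar>(1 / l) gchoose n\<bar>" for n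
      using assms(1) lz mult_left_mono[OF power_le_one[of "\<bar>l * z\<bar>" n], of "\<bar>(1 / l) gchoose n\<bar>"]
      by (simp add: degen_exp_fps_nth abs_mult power_abs)
  qed (use assms(1) in simp)
qed

lemma Ints_nonneg_imp_Nats:
  "(x :: real) \<in> \<int> \<Longrightarrow> 0 \<le> x \<Longrightarrow> x \<in> \<nat>"
  by (auto elim!: Ints_cases intro: of_nat_in_Nats simp flip: of_nat_nat)

text \<open>A natural exponent is the binomial theorem. Otherwise this is an Abel-type limit: the
  identity holds at \<open>s * z\<close> for \<open>0 < s < 1\<close>, and both sides pass to the
  limit as \<open>s\<close> tends to 1 from the left.\<close>

lemma degen_exp_fps_suminf:
  assumes "l > 0" and z: "1 / l \<in> \<nat> \<or> \<bar>l * z\<bar> \<le> 1"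
  shows "(\<Sum>n. fps_nth (degen_exp_fps l 1) n * z ^ n) = degen_exp l 1 z"
proof (cases "1 / l \<in> \<nat>")
  case True
  then obtain m where m: "1 / l = real m" by (auto elim: Nats_cases)
  have "(\<Sum>n. fps_nth (degen_exp_fps l 1) n * z ^ n) = (\<Sum>n\<le>m. fps_nth (degen_exp_fps l 1) n * z ^ n)"
    using assms(1) m by (intro suminf_finite) (auto simp: degen_exp_fps_nth simp flip: binomial_gbinomial)
  also have "\<dots> = (l * z + 1) ^ m"
    unfolding binomial_ring using assms(1) m
    by (intro sum.cong) (auto simp: degen_exp_fps_nth simp flip: binomial_gbinomial)
  also have "\<dots> = degen_exp l 1 z"
    by (simp add: degen_exp_def m add.commute power_int_def)
  finally show ?thesis .
next
  case False
  then have lz: "\<bar>l * z\<bar> \<le> 1" and not_int: "1 / l \<notin> \<int>"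
    using z assms(1) Ints_nonneg_imp_Nats[of "1 / l"] by auto
  let ?e = "\<lambda>n. fps_nth (degen_exp_fps l 1) n"
  let ?F = "at_left (1 :: real)"
  have in01: "eventually (\<lambda>s :: real. 0 < s \<and> s < 1) ?F"
    using eventually_at_left_real[of 0 "1 :: real"] by simp
  have bound: "norm (?e n * (s * z) ^ n) \<le> \<bar>?e n * z ^ n\<bar>" if "0 < s" "s < 1" for n s
    using that mult_left_mono[OF power_le_one[of s n], of "\<bar>?e n * z ^ n\<bar>"]
    by (simp add: power_mult_distrib abs_mult mult_ac)
  \<comment> \<open>The terms at \<open>s * z\<close> are dominated by those at \<open>z\<close>,
    which lets the limit pass under the sum.\<close>
  have "((\<lambda>s. \<Sum>n. ?e n * (s * z) ^ n) \<longlongrightarrow> (\<Sum>n. ?e n * z ^ n)) ?F"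
  proof (rule tannerys_theorem[where M = "\<lambda>n. \<bar>?e n * z ^ n\<bar>", THEN conjunct2, THEN conjunct2])
    show "((\<lambda>s. ?e n * (s * z) ^ n) \<longlongrightarrow> ?e n * z ^ n) ?F" for n
      by (rule tendsto_eq_intros refl | simp)+
    show "eventually (\<lambda>(n, s). norm (?e n * (s * z) ^ n) \<le> \<bar>?e n * z ^ n\<bar>) (at_top \<times>\<^sub>F ?F)"
      by (rule eventually_mono[OF eventually_prodI[OF always_eventually in01, of "\<lambda>_. True" at_top]])
        (use bound in auto)
    show "summable (\<lambda>n. \<bar>?e n * z ^ n\<bar>)"
      using assms by (rule degen_exp_fps_abs_summable)
  qed auto
  moreover have "((\<lambda>s. \<Sum>n. ?e n * (s * z) ^ n) \<longlongrightarrow> degen_exp l 1 z) ?F"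
  proof (rule Lim_transform_eventually)
    have small: "\<bar>l * (s * z)\<bar> < 1" if s: "0 < s" "s < 1" for s
    proof -
      have "\<bar>l * (s * z)\<bar> = s * \<bar>l * z\<bar>"
        using s by (simp add: abs_mult)
      also have "\<dots> \<le> s * 1"
        using s lz by (intro mult_left_mono) auto
      finally show ?thesis using s by simp
    qed
    then show "eventually (\<lambda>s. (1 + l * (s * z)) powr (1 / l) = (\<Sum>n. ?e n * (s * z) ^ n)) ?F"
      using in01 assms(1) not_int degen_exp_sums[of l "_ * z" 1]
      by (auto elim!: eventually_mono simp: sums_iff degen_exp_def)
    \<comment> \<open>At the boundary point \<open>l * z = -1\<close> the base tends to 0; there the
      limit of \<open>powr\<close> rests on nonnegative bases and the positive exponent.\<close>
    have nn: "eventually (\<lambda>s. 0 \<le> 1 + l * (s * z)) ?F"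
      using in01
    proof eventually_elim
      case (elim s)
      then show ?case using small[of s] by linarith
    qed
    have "((\<lambda>s. (1 + l * (s * z)) powr (1 / l)) \<longlongrightarrow> (1 + l * (1 * z)) powr (1 / l)) ?F"
      using nn assms(1) by (intro tendsto_powr' tendsto_intros) auto
    then show "((\<lambda>s. (1 + l * (s * z)) powr (1 / l)) \<longlongrightarrow> degen_exp l 1 z) ?F"
      using not_int by (simp add: degen_exp_def)
  qed
  ultimately show ?thesis
    using tendsto_unique[of ?F] by auto
qed

text \<open>The radius of convergence of the binomial series is infinite for a natural exponent and
  1 otherwise.\<close>

lemma degen_exp_fps_summableD:
  assumes "l > 0" and "summable (\<lambda>n. fps_nth (degen_exp_fps l 1) n * z ^ n)"
  shows "1 / l \<in> \<nat> \<or> \<bar>l * z\<bar> \<le> 1"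
proof -
  have "summable (\<lambda>n. ((1 / l) gchoose n) * (l * z) ^ n)"
    using assms by (simp add: degen_exp_fps_nth)
  then have "ereal (norm (l * z)) \<le> conv_radius (\<lambda>n. (1 / l) gchoose n)"
    by (rule conv_radius_geI)
  then show ?thesis
    by (auto simp: conv_radius_gchoose split: if_splits)
qed

section \<open>The generating function of the degenerate Bell polynomials\<close>

text \<open>Subtracting 1 removes the constant term, as the composition requires, and leaves terms
  dominated by those of the binomial series; hence the composition lemma applies on the whole closed
  disc.\<close>

lemma degen_bell_gf_sums:
  fixes \<alpha> :: real
  assumes "l > 0" and z: "1 / l \<in> \<nat> \<or> \<bar>l * z\<bar> \<le> 1"
    and b: "b = fps_exp \<alpha> oo (degen_exp_fps l 1 - 1)"
  shows "summable (\<lambda>n. \<bar>fps_nth b n * z ^ n\<bar>)"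
    and "(\<lambda>n. fps_nth b n * z ^ n) sums exp (\<alpha> * (degen_exp l 1 z - 1))"
proof -
  let ?e = "degen_exp_fps l 1"
  have e0: "fps_nth ?e 0 = 1"
    by (simp add: degen_exp_fps_def degen_falling_def)
  have e: "(\<lambda>n. fps_nth ?e n * z ^ n) sums degen_exp l 1 z"
    using degen_exp_fps_abs_summable[OF assms(1) z] degen_exp_fps_suminf[OF assms(1) z]
    by (simp add: sums_iff summable_rabs_cancel)
  have "(\<lambda>n. fps_nth 1 n * z ^ n) sums 1"
    using sums_single[of 0 "\<lambda>_. 1 :: real"] by (simp add: if_distrib if_distribR cong: if_cong)
  with e have "(\<lambda>n. fps_nth (?e - 1) n * z ^ n) sums (degen_exp l 1 z - 1)"
    using sums_diff[OF e] by (simp add: left_diff_distrib)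
  then have sum: "(\<Sum>n. fps_nth (?e - 1) n * z ^ n) = degen_exp l 1 z - 1"
    by (simp add: sums_iff)
  have abs: "summable (\<lambda>n. \<bar>fps_nth (?e - 1) n * z ^ n\<bar>)"
  proof (rule summable_comparison_test'[OF degen_exp_fps_abs_summable[OF assms(1) z], of 0])
    show "norm \<bar>fps_nth (?e - 1) n * z ^ n\<bar> \<le> \<bar>fps_nth ?e n * z ^ n\<bar>" for n
      using e0 by (cases n) auto
  qed
  show "summable (\<lambda>n. \<bar>fps_nth b n * z ^ n\<bar>)"
    unfolding b using e0 by (intro fps_exp_compose_abs_summable abs) simp
  show "(\<lambda>n. fps_nth b n * z ^ n) sums exp (\<alpha> * (degen_exp l 1 z - 1))"
    unfolding b sum[symmetric] using e0 by (intro fps_exp_compose_abs_summable abs) simp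
qed

text \<open>Used to show that an integrable exponential moment forces \<open>z\<close> into the
  region where the closed form is known. For \<open>\<alpha> = 0\<close> the composition is the
  constant 1 and converges everywhere.\<close>

lemma degen_bell_gf_summableD:
  assumes "l > 0" "\<alpha> \<noteq> 0"
    and "summable (\<lambda>n. fps_nth (fps_exp \<alpha> oo (degen_exp_fps l 1 - 1)) n * z ^ n)"
  shows "1 / l \<in> \<nat> \<or> \<bar>l * z\<bar> \<le> 1"
proof (rule ccontr)
  assume contra: "\<not> (1 / l \<in> \<nat> \<or> \<bar>l * z\<bar> \<le> 1)"
  then have not_int: "1 / l \<notin> \<int>" and lz: "\<bar>l * z\<bar> > 1"
    using Ints_nonneg_imp_Nats[of "1 / l"] assms(1) by auto
  define b where "b = fps_nth (fps_exp \<alpha> oo (degen_exp_fps l 1 - 1))"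
  define r where "r = 1 / l"
  define \<xi> :: complex where "\<xi> = of_real (- r)"
  \<comment> \<open>The series converges on this open disc, which contains the branch point
    \<open>\<xi>\<close> because \<open>\<bar>l * z\<bar> > 1\<close>.\<close>
  define S where "S = ball (0 :: complex) \<bar>z\<bar>"
  define F where "F w = (\<Sum>n. of_real (b n) * w ^ n)" for w :: complex
  \<comment> \<open>The factor \<open>exp \<alpha>\<close> cancels the \<open>- 1\<close> in the
    exponent of the generating function, so that \<open>D\<close> vanishes at \<open>\<xi>\<close>,
    where the degenerate exponential is 0.\<close>
  define D where "D w = of_real (exp \<alpha>) * F w - 1" for w
  define x where "x y = \<xi> + of_real (y * r)" for y
  have r: "r > 0" "l * r = 1" using assms(1) by (auto simp: r_def)
  have rz: "r < \<bar>z\<bar>" using lz assms(1) by (simp add: r_def abs_mult field_simps)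
  have conv: "summable (\<lambda>n. of_real (b n) * w ^ n)" if "norm w < \<bar>z\<bar>" for w :: complex
  proof (rule powser_inside[of _ "of_real z"])
    show "summable (\<lambda>n. of_real (b n) * (of_real z) ^ n :: complex)"
      using assms(3) unfolding b_def of_real_power[symmetric] of_real_mult[symmetric]
      by (rule summable_of_real)
  qed (use that in simp)
  have "F holomorphic_on S"
    unfolding S_def
    by (rule power_series_holomorphic[where a = "\<lambda>n. of_real (b n)"])
      (auto simp: F_def intro!: conv summable_sums)
  then have hol: "D holomorphic_on S"
    unfolding D_def by (intro holomorphic_intros)
  have \<xi>S: "\<xi> \<in> S" using rz r by (simp add: S_def \<xi>_def)
  have x_eq: "x y = of_real ((y - 1) * r)" for y
    by (simp add: x_def \<xi>_def algebra_simps)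
  \<comment> \<open>At the point \<open>x y\<close> the base \<open>1 + l * x y\<close> equals
    \<open>y\<close>; for \<open>0 \<le> y < 1\<close> this point lies in the closed disc, where the
    sum is already known.\<close>
  have D_x: "D (x y) = of_real (exp (\<alpha> * y powr r) - 1)" if y: "0 \<le> y" "y < 1" for y
  proof -
    let ?t = "(y - 1) * r"
    have lt: "l * ?t = y - 1" using r by (simp add: mult.left_commute)
    have "1 / l \<in> \<nat> \<or> \<bar>l * ?t\<bar> \<le> 1"
      unfolding lt using y by simp
    then have "(\<lambda>n. b n * ?t ^ n) sums exp (\<alpha> * (degen_exp l 1 ?t - 1))"
      unfolding b_def by (rule degen_bell_gf_sums(2)[OF assms(1) _ refl])
    then have "(\<lambda>n. of_real (b n) * of_real ?t ^ n) sums
        (of_real (exp (\<alpha> * (degen_exp l 1 ?t - 1))) :: complex)"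
      unfolding of_real_power[symmetric] of_real_mult[symmetric] by (rule sums_of_real)
    then have "F (x y) = of_real (exp (\<alpha> * (degen_exp l 1 ?t - 1)))"
      unfolding F_def x_eq by (simp only: sums_iff)
    also have "degen_exp l 1 ?t = y powr r"
      using not_int lt by (simp add: degen_exp_def r_def)
    finally show ?thesis
      unfolding D_def
      by (simp add: exp_add[symmetric] algebra_simps flip: of_real_mult)
  qed
  have "D \<xi> = 0" using D_x[of 0] r by (simp add: x_def)
  \<comment> \<open>Needed for the zero at \<open>\<xi>\<close> to have a finite order
    \<open>m\<close>.\<close>
  have nonconst: "\<not> D constant_on S"
  proof
    assume "D constant_on S"
    moreover have "x (1/2) \<in> S"
      using r rz by (simp add: x_eq S_def flip: of_real_mult)
    ultimately have "D (x (1/2)) = 0"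
      using \<open>D \<xi> = 0\<close> \<xi>S by (auto simp: constant_on_def)
    then show False
      using D_x[of "1/2"] assms(2) by (simp del: of_real_diff)
  qed
  obtain g \<rho> m where m: "0 < m" and \<rho>: "0 < \<rho>" "ball \<xi> \<rho> \<subseteq> S"
    and g: "g holomorphic_on ball \<xi> \<rho>"
      "\<And>w. w \<in> ball \<xi> \<rho> \<Longrightarrow> D w = (w - \<xi>) ^ m * g w"
      "\<And>w. w \<in> ball \<xi> \<rho> \<Longrightarrow> g w \<noteq> 0"
  proof (rule holomorphic_factor_zero_nonconstant[OF hol _ _ \<xi>S \<open>D \<xi> = 0\<close> nonconst])
    show "open S" "connected S" by (simp_all add: S_def)
  qed (rule that)
  let ?F = "at_right (0 :: real)"
  have g\<xi>: "g \<xi> \<noteq> 0" using g(3) \<rho>(1) by simp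
  have "isCont g \<xi>"
    using holomorphic_on_imp_continuous_on[OF g(1)] \<rho>(1)
    by (simp add: continuous_on_eq_continuous_at)
  moreover have "(x \<longlongrightarrow> \<xi>) ?F"
    unfolding x_def by (rule tendsto_eq_intros refl | simp)+
  ultimately have g_lim: "((\<lambda>y. g (x y)) \<longlongrightarrow> g \<xi>) ?F"
    by (rule isCont_tendsto_compose)
  have powr_lim: "((\<lambda>y. y powr r) \<longlongrightarrow> 0) ?F"
    using r(1) by real_asymp
  \<comment> \<open>On the real segment \<open>D (x y)\<close> behaves like
    \<open>\<alpha> * y powr r\<close>, by the derivative of \<open>exp (\<alpha> * h)\<close> at
    \<open>h = 0\<close>.\<close>
  have exp_lim: "((\<lambda>y. (exp (\<alpha> * y powr r) - 1) / y powr r) \<longlongrightarrow> \<alpha>) ?F"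
  proof -
    have "((\<lambda>h. exp (\<alpha> * h)) has_real_derivative \<alpha>) (at 0)"
      by (auto intro!: derivative_eq_intros)
    then have "((\<lambda>h. (exp (\<alpha> * h) - 1) / h) \<longlongrightarrow> \<alpha>) (at 0)"
      by (simp add: has_field_derivative_iff)
    moreover have "filterlim (\<lambda>y. y powr r) (at 0) ?F"
      using powr_lim by (auto simp: filterlim_at intro: eventually_mono[OF eventually_at_right_less])
    ultimately show ?thesis by (rule filterlim_compose)
  qed
  have "eventually (\<lambda>y. y < 1 \<and> y * r < \<rho>) ?F"
    unfolding eventually_at_right_field using r \<rho>(1)
    by (intro exI[of _ "min 1 (\<rho> / r)"]) (auto simp: field_simps)
  \<comment> \<open>Comparing the two descriptions of \<open>norm (D (x y))\<close>, from the zero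
    of order \<open>m\<close> and from the exponential, leaves only
    \<open>y powr (r - real m)\<close>, which must then have a positive finite limit.\<close>
  then have "eventually (\<lambda>y. r ^ m * norm (g (x y)) / \<bar>(exp (\<alpha> * y powr r) - 1) / y powr r\<bar> = y powr (r - real m)) ?F"
    using eventually_at_right_less[of "0 :: real"]
  proof eventually_elim
    case (elim y)
    have "x y \<in> ball \<xi> \<rho>" using elim r by (simp add: x_def dist_norm norm_mult abs_mult)
    then have "norm (D (x y)) = (y * r) ^ m * norm (g (x y))"
      using g(2) elim r by (simp add: x_def norm_mult norm_power)
    moreover have "norm (D (x y)) = \<bar>exp (\<alpha> * y powr r) - 1\<bar>"
      using D_x[of y] elim by (simp only: norm_of_real)
    ultimately have eq: "\<bar>exp (\<alpha> * y powr r) - 1\<bar> = (y * r) ^ m * norm (g (x y))" by simp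
    have "exp (\<alpha> * y powr r) \<noteq> 1" using elim assms(2) by simp
    with eq elim r show ?case
      by (auto simp: powr_diff powr_realpow abs_divide power_mult_distrib field_simps)
  qed
  moreover have "((\<lambda>y. r ^ m * norm (g (x y)) / \<bar>(exp (\<alpha> * y powr r) - 1) / y powr r\<bar>) \<longlongrightarrow>
      r ^ m * norm (g \<xi>) / \<bar>\<alpha>\<bar>) ?F"
    using assms(2) by (intro tendsto_intros g_lim exp_lim) auto
  ultimately have lim: "((\<lambda>y. y powr (r - real m)) \<longlongrightarrow> r ^ m * norm (g \<xi>) / \<bar>\<alpha>\<bar>) ?F"
    by (rule Lim_transform_eventually[rotated])
  have pos: "r ^ m * norm (g \<xi>) / \<bar>\<alpha>\<bar> > 0" using r g\<xi> assms(2) by simp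
  \<comment> \<open>Since \<open>r\<close> is not an integer, the exponent \<open>r - real m\<close>
    is nonzero, and the limit can only be 0 or infinity.\<close>
  consider "r > real m" | "r < real m"
    using not_int unfolding r_def by (metis Ints_of_nat linorder_neqE_linordered_idom)
  then show False
  proof cases
    case 1
    then have "((\<lambda>y. y powr (r - real m)) \<longlongrightarrow> 0) ?F" by real_asymp
    then show False using tendsto_unique[OF _ lim] pos by auto
  next
    case 2
    then have "filterlim (\<lambda>y. y powr (r - real m)) at_top ?F" by real_asymp
    then show False using not_tendsto_and_filterlim_at_infinity[OF _ lim] filterlim_at_top_imp_at_infinity by auto
  qed
qed

section \<open>Expectations as series, and moments\<close>

text \<open>The law of \<open>X\<close> has density \<open>p\<close> with respect to counting
  measure, so integrability becomes absolute convergence of a series and the expectation its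
  sum.\<close>

lemma (in prob_space) nat_valued_integral:
  fixes X :: "'a \<Rightarrow> nat" and g :: "nat \<Rightarrow> real"
  assumes X [measurable]: "X \<in> M \<rightarrow>\<^sub>M count_space UNIV"
  defines "p \<equiv> \<lambda>k. prob {\<omega> \<in> space M. X \<omega> = k}"
  shows "integrable M (\<lambda>\<omega>. g (X \<omega>)) \<longleftrightarrow> summable (\<lambda>k. \<bar>p k * g k\<bar>)"
    and "integrable M (\<lambda>\<omega>. g (X \<omega>)) \<Longrightarrow> expectation (\<lambda>\<omega>. g (X \<omega>)) = (\<Sum>k. p k * g k)"
proof -
  have distr: "distr M (count_space UNIV) X = density (count_space UNIV) p"
  proof (rule measure_eqI_countable[where A = UNIV])
    fix k
    show "emeasure (distr M (count_space UNIV) X) {k} = emeasure (density (count_space UNIV) p) {k}"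
      by (auto simp: emeasure_distr emeasure_density p_def emeasure_eq_measure
          nn_integral_count_space_indicator intro!: arg_cong[where f = prob])
  qed auto
  have p: "AE k in count_space UNIV. 0 \<le> p k" by (simp add: p_def)
  have "integrable M (\<lambda>\<omega>. g (X \<omega>)) \<longleftrightarrow> integrable (distr M (count_space UNIV) X) g"
    by (simp add: integrable_distr_eq)
  also have "\<dots> \<longleftrightarrow> integrable (count_space UNIV) (\<lambda>k. p k * g k)"
    unfolding distr by (rule integrable_real_density) (use p in auto)
  finally have i: "integrable M (\<lambda>\<omega>. g (X \<omega>)) \<longleftrightarrow> integrable (count_space UNIV) (\<lambda>k. p k * g k)" .
  then show "integrable M (\<lambda>\<omega>. g (X \<omega>)) \<longleftrightarrow> summable (\<lambda>k. \<bar>p k * g k\<bar>)"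
    by (simp add: integrable_count_space_nat_iff)
  assume "integrable M (\<lambda>\<omega>. g (X \<omega>))"
  have "expectation (\<lambda>\<omega>. g (X \<omega>)) = integral\<^sup>L (distr M (count_space UNIV) X) g"
    by (simp add: integral_distr)
  also have "\<dots> = (\<integral>k. p k * g k \<partial>count_space UNIV)"
    unfolding distr by (rule integral_real_density) (use p in auto)
  also have "\<dots> = (\<Sum>k. p k * g k)"
    using i \<open>integrable M (\<lambda>\<omega>. g (X \<omega>))\<close> by (intro integral_count_space_nat) simp
  finally show "expectation (\<lambda>\<omega>. g (X \<omega>)) = (\<Sum>k. p k * g k)" .
qed

text \<open>Dominated convergence: all partial sums of the exponential series are bounded by
  \<open>exp (\<bar>Y \<omega>\<bar> * \<bar>t\<bar>)\<close>. The absolute values make the bound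
  hold for either sign of \<open>t\<close>.\<close>

lemma (in prob_space) moments_sums_mgf:
  fixes Y :: "'a \<Rightarrow> real"
  assumes [measurable]: "Y \<in> borel_measurable M"
    and int: "integrable M (\<lambda>\<omega>. exp (\<bar>Y \<omega>\<bar> * \<bar>t\<bar>))"
  shows "(\<lambda>n. expectation (\<lambda>\<omega>. Y \<omega> ^ n) * (t ^ n / fact n)) sums mgf M Y t"
proof -
  have partial: "(\<Sum>k<n. \<bar>Y \<omega> ^ k * (t ^ k / fact k)\<bar>) \<le> exp (\<bar>Y \<omega>\<bar> * \<bar>t\<bar>)" for n \<omega>
  proof -
    have s: "(\<lambda>k. \<bar>Y \<omega> ^ k * (t ^ k / fact k)\<bar>) sums exp (\<bar>Y \<omega>\<bar> * \<bar>t\<bar>)"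
      using exp_converges[of "\<bar>Y \<omega>\<bar> * \<bar>t\<bar>"]
      by (simp add: abs_mult power_abs power_mult_distrib divide_inverse mult_ac)
    show ?thesis using sum_le_suminf[of "\<lambda>k. \<bar>Y \<omega> ^ k * (t ^ k / fact k)\<bar>" "{..<n}"] s
      by (simp add: sums_iff)
  qed
  have int_n: "integrable M (\<lambda>\<omega>. Y \<omega> ^ n * (t ^ n / fact n))" for n
  proof (rule Bochner_Integration.integrable_bound[OF int])
    show "AE \<omega> in M. norm (Y \<omega> ^ n * (t ^ n / fact n)) \<le> norm (exp (\<bar>Y \<omega>\<bar> * \<bar>t\<bar>))"
    proof (rule AE_I2)
      fix \<omega>
      have "\<bar>Y \<omega> ^ n * (t ^ n / fact n)\<bar> \<le> (\<Sum>k<Suc n. \<bar>Y \<omega> ^ k * (t ^ k / fact k)\<bar>)"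
        by (rule member_le_sum) auto
      with partial[of \<omega> "Suc n"] show "norm (Y \<omega> ^ n * (t ^ n / fact n)) \<le> norm (exp (\<bar>Y \<omega>\<bar> * \<bar>t\<bar>))"
        by simp
    qed
  qed simp
  have "(\<lambda>n. expectation (\<lambda>\<omega>. \<Sum>k<n. Y \<omega> ^ k * (t ^ k / fact k))) \<longlonglongrightarrow> expectation (\<lambda>\<omega>. exp (Y \<omega> * t))"
  proof (rule integral_dominated_convergence[OF _ _ int])
    show "AE \<omega> in M. (\<lambda>n. \<Sum>k<n. Y \<omega> ^ k * (t ^ k / fact k)) \<longlonglongrightarrow> exp (Y \<omega> * t)"
    proof (rule AE_I2)
      fix \<omega>
      show "(\<lambda>n. \<Sum>k<n. Y \<omega> ^ k * (t ^ k / fact k)) \<longlonglongrightarrow> exp (Y \<omega> * t)"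
        using exp_converges[of "Y \<omega> * t"]
        by (simp add: sums_def power_mult_distrib divide_inverse mult_ac)
    qed
    show "AE \<omega> in M. norm (\<Sum>k<n. Y \<omega> ^ k * (t ^ k / fact k)) \<le> exp (\<bar>Y \<omega>\<bar> * \<bar>t\<bar>)" for n
      using partial by (intro AE_I2) (auto intro: order_trans[OF sum_abs])
  qed auto
  \<comment> \<open>At \<open>t = 0\<close> a moment may fail to exist; its integral is then 0 by
    default, and the factor \<open>t ^ n\<close> is 0 as well for \<open>n > 0\<close>, so the
    factor can be pulled out in every case.\<close>
  moreover have "expectation (\<lambda>\<omega>. \<Sum>k<n. Y \<omega> ^ k * (t ^ k / fact k)) =
      (\<Sum>k<n. expectation (\<lambda>\<omega>. Y \<omega> ^ k) * (t ^ k / fact k))" for n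
    using int_n by (subst Bochner_Integration.integral_sum) (auto simp: integral_mult_left_zero)
  ultimately show ?thesis
    by (simp add: sums_def mgf_def)
qed

section \<open>The moment generating function of the degenerate Bell distribution\<close>

text \<open>A Bochner integral is 0 by default when it does not exist, whereas the closed form is
  positive; hence the first conjunct asks for integrability. The second ensures it wherever the
  binomial series converges at \<open>exp t * \<theta>\<close>. The third uses
  \<open>\<bar>t\<bar>\<close> because expanding into moments requires absolute convergence.\<close>

theorem theorem3:
  fixes M :: "'a measure" and X :: "'a \<Rightarrow> nat" and l \<alpha> \<theta> t :: real
  assumes "0 < l" and "l \<le> 1"
    and "degen_bell_distributed M X l \<alpha> \<theta>"
  shows "(integrable M (\<lambda>\<omega>. exp (real (X \<omega>) * t)) \<longrightarrow>
           mgf M (\<lambda>\<omega>. real (X \<omega>)) t = exp (\<alpha> * (degen_exp l 1 (exp t * \<theta>) - degen_exp l 1 \<theta>))) \<and>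
         (summable (\<lambda>n. fps_nth (degen_exp_fps l 1) n * (exp t * \<theta>) ^ n) \<longrightarrow>
           integrable M (\<lambda>\<omega>. exp (real (X \<omega>) * t))) \<and>
         (integrable M (\<lambda>\<omega>. exp (real (X \<omega>) * \<bar>t\<bar>)) \<longrightarrow>
           (\<lambda>n. prob_space.expectation M (\<lambda>\<omega>. real (X \<omega>) ^ n) * (t ^ n / fact n))
             sums mgf M (\<lambda>\<omega>. real (X \<omega>)) t)"
proof -
  interpret prob_space M using assms(3) by (simp add: degen_bell_distributed_def)
  have X [measurable]: "X \<in> M \<rightarrow>\<^sub>M count_space UNIV"
    using assms(3) by (simp add: degen_bell_distributed_def)
  define b where "b = fps_exp \<alpha> oo (degen_exp_fps l 1 - 1)"
  define C where "C = exp (- \<alpha> * (degen_exp l 1 \<theta> - 1))"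
  define z where "z = exp t * \<theta>"
  \<comment> \<open>The factorials cancel and \<open>exp (real k * t)\<close> is absorbed into
    \<open>z ^ k\<close>, which leaves the generating function at \<open>z\<close> up to the
    constant \<open>C\<close>.\<close>
  have p: "prob {\<omega> \<in> space M. X \<omega> = k} * exp (real k * t) = C * (fps_nth b k * z ^ k)" for k
    using assms(3)
    by (simp add: degen_bell_distributed_def degen_bell_def C_def b_def z_def
        power_mult_distrib exp_of_nat_mult)
  have C: "C \<noteq> 0" by (simp add: C_def)
  have int_iff: "integrable M (\<lambda>\<omega>. exp (real (X \<omega>) * t)) \<longleftrightarrow> summable (\<lambda>k. \<bar>fps_nth b k * z ^ k\<bar>)"
    using nat_valued_integral(1)[OF X, of "\<lambda>k. exp (real k * t)"] C
    unfolding p by (simp add: abs_mult[of C] summable_cmult_iff)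
  have mgf: "mgf M (\<lambda>\<omega>. real (X \<omega>)) t = exp (\<alpha> * (degen_exp l 1 z - degen_exp l 1 \<theta>))"
    if int: "integrable M (\<lambda>\<omega>. exp (real (X \<omega>) * t))"
  proof -
    have "(\<lambda>k. fps_nth b k * z ^ k) sums exp (\<alpha> * (degen_exp l 1 z - 1))"
    \<comment> \<open>For \<open>\<alpha> = 0\<close> the series is 1 at every \<open>z\<close>,
      also outside the disc, so this case cannot go through the divergence argument.\<close>
    proof (cases "\<alpha> = 0")
      case True
      then have "b = 1" by (simp add: b_def)
      then show ?thesis
        using True sums_single[of 0 "\<lambda>_. 1 :: real"] by (simp add: if_distrib if_distribR cong: if_cong)
    next
      case False
      have "summable (\<lambda>k. fps_nth b k * z ^ k)"
        using int unfolding int_iff by (rule summable_rabs_cancel)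
      then have "1 / l \<in> \<nat> \<or> \<bar>l * z\<bar> \<le> 1"
        unfolding b_def using assms(1) False by (rule degen_bell_gf_summableD[rotated 2])
      then show ?thesis
        using assms(1) b_def by (intro degen_bell_gf_sums)
    qed
    then have "(\<lambda>k. C * (fps_nth b k * z ^ k)) sums (C * exp (\<alpha> * (degen_exp l 1 z - 1)))"
      by (rule sums_mult)
    then have "mgf M (\<lambda>\<omega>. real (X \<omega>)) t = C * exp (\<alpha> * (degen_exp l 1 z - 1))"
      using nat_valued_integral(2)[OF X, of "\<lambda>k. exp (real k * t)"] int
      unfolding p mgf_def by (simp add: sums_iff)
    then show ?thesis
      by (simp add: C_def algebra_simps flip: exp_add)
  qed
  have "integrable M (\<lambda>\<omega>. exp (real (X \<omega>) * t))"
    if "summable (\<lambda>n. fps_nth (degen_exp_fps l 1) n * z ^ n)"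
    unfolding int_iff
    using assms(1) degen_exp_fps_summableD[OF assms(1) that] b_def by (rule degen_bell_gf_sums)
  moreover have "(\<lambda>n. expectation (\<lambda>\<omega>. real (X \<omega>) ^ n) * (t ^ n / fact n)) sums mgf M (\<lambda>\<omega>. real (X \<omega>)) t"
    if "integrable M (\<lambda>\<omega>. exp (real (X \<omega>) * \<bar>t\<bar>))"
    using that by (intro moments_sums_mgf) auto
  ultimately show ?thesis
    using mgf unfolding z_def by blast
qed

end
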